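(* Let $A$ be a definite $n\times n$ max-plus matrix with at least one off-diagonal entry different from $-\infty$, and let $\tau$ be any critical cyclic permutation of $\tilde A$, acting on the subset $K(\tau)\subseteq\{1,\dots,n\}$. 1) If $\lambda(\tilde A)>-\infty$, then for any $y\in\mathrm{eig}(A)$ one has $d_H(y,\Gamma(\mathrm{eig}(A)))\le-\lambda(\tilde A)$. 2) Let $\mu\in\mathbb{R}$ be such that $\lambda(\tilde A)\le\mu<0$ if $\lambda(\tilde A)>-\infty$, or such that $-\infty<\mu<0$ if $\lambda(\tilde A)=-\infty$. Then for any $y\in\mathrm{eig}(A_\mu)$ one has $d_H(y,\Gamma(\mathrm{eig}(A)))\ge-\mu$. 3) If $\lambda(\tilde A)>-\infty$, then for any $i,j\in K(\tau)$ such that $j=\tau(i)$ and any $y\in\mathrm{eig}(A_{\lambda})$, where $A_\lambda=A_{\mu}$ with $\mu=\lambda(\tilde A)$, the distance between $y$ and the face $\Gamma_{ij}$ of $\mathrm{eig}(A)$ is $d_H(y,\Gamma_{ij})=-\lambda(\tilde A)$.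
   Context: All arithmetic is written conventionally on $\mathbb{R}_{\max}=\mathbb{R}\cup\{-\infty\}$, the semiring with addition $\max$ and multiplication $+$; a max-plus matrix is a matrix with entries in $\mathbb{R}_{\max}$, and $(A\odot x)_i=\max_k(A_{ik}+x_k)$. Maximal cycle mean: $\lambda(A)=\max_{\tau}\frac{1}{|K(\tau)|}\sum_{i\in K(\tau)}A_{i\tau(i)}$, where $\tau$ ranges over all cyclic permutations of nonempty subsets $K(\tau)\subseteq\{1,\dots,n\}$ (singletons included); a cyclic permutation is critical if it attains this maximum. $A$ is definite if $\lambda(A)=0$ and $A_{ii}=0$ for all $i$. $\tilde A$ is the matrix obtained from $A$ by replacing the diagonal entries by $-\infty$. For $\mu\in\mathbb{R}$, $A_\mu$ is the matrix with $(A_\mu)_{ii}=0$ and $(A_\mu)_{ij}=A_{ij}-\mu$ for $i\ne j$; for $\mu\ge\lambda(\tilde A)$ it is definite. Throughout, only eigenvectors with full support (all components real) are considered: for definite $B$, $\mathrm{eig}(B)=\{x\in\mathbb{R}^n : B\odot x=x\}$. For $i\neq j$ with $A_{ij}\ne-\infty$, the supporting plane of $\mathrm{eig}(A)$ is $X_{ij}=\{x\in\mathbb{R}^n : x_i-x_j=A_{ij}\}$ and the face is $\Gamma_{ij}=X_{ij}\cap\mathrm{eig}(A)$. The boundary $\Gamma(\mathrm{eig}(A))$ is the union of all faces $\Gamma_{ij}$. Hilbert distance of $x,y\in\mathbb{R}^n$: $d_H(x,y)=\max_{i,j}(x_i-x_j-y_i+y_j)$. The distance from $y$ to a set $Z$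 is $d_H(y,Z)=\inf_{z\in Z}d_H(y,z)$. *)

theory Defs
  imports "HOL-Analysis.Analysis" "HOL-Combinatorics.Orbits"
begin

text \<open>
  The max-plus semiring is represented inside \<^typ>\<open>ereal\<close>: its elements are the extended reals
  other than \<open>\<infinity>\<close>, where \<open>max\<close> and \<open>+\<close> have their max-plus meaning (in particular
  \<open>-\<infinity>\<close> is absorbing for \<open>+\<close>). Indices range over an arbitrary finite type instead of
  \<open>{1..n}\<close>.
\<close>

definition maxplus_matrix :: "ereal ^ 'n ^ 'm \<Rightarrow> bool" where
  "maxplus_matrix A \<longleftrightarrow> (\<forall>i j. A $ i $ j \<noteq> \<infinity>)"

definition mp_mult_vec :: "ereal ^ 'n ^ 'm \<Rightarrow> ereal ^ 'n \<Rightarrow> ereal ^ 'm" (infixr "\<odot>" 70) where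
  "A \<odot> x = (\<chi> i. MAX k. A $ i $ k + x $ k)"

text \<open>
  A singleton \<open>K\<close> with \<open>\<tau> = id\<close> is included; \<open>K\<close> is nonempty by definition of \<^const>\<open>cyclic_on\<close>.
\<close>

definition cyclic_perm :: "'n set \<Rightarrow> ('n \<Rightarrow> 'n) \<Rightarrow> bool" where
  "cyclic_perm K \<tau> \<longleftrightarrow> \<tau> permutes K \<and> cyclic_on \<tau> K"

definition cycle_mean :: "ereal ^ 'n ^ 'n \<Rightarrow> 'n set \<Rightarrow> ('n \<Rightarrow> 'n) \<Rightarrow> ereal" where
  "cycle_mean A K \<tau> = (\<Sum>i\<in>K. A $ i $ \<tau> i) / ereal (real (card K))"

definition max_cycle_mean :: "ereal ^ 'n ^ 'n \<Rightarrow> ereal" where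
  "max_cycle_mean A = Max {cycle_mean A K \<tau> | K \<tau>. cyclic_perm K \<tau>}"

definition critical_perm :: "ereal ^ 'n ^ 'n \<Rightarrow> 'n set \<Rightarrow> ('n \<Rightarrow> 'n) \<Rightarrow> bool" where
  "critical_perm A K \<tau> \<longleftrightarrow> cyclic_perm K \<tau> \<and> cycle_mean A K \<tau> = max_cycle_mean A"

definition definite :: "ereal ^ 'n ^ 'n \<Rightarrow> bool" where
  "definite A \<longleftrightarrow> max_cycle_mean A = 0 \<and> (\<forall>i. A $ i $ i = 0)"

definition off_diag :: "ereal ^ 'n ^ 'n \<Rightarrow> ereal ^ 'n ^ 'n" where
  "off_diag A = (\<chi> i j. if i = j then -\<infinity> else A $ i $ j)"

definition shift_off_diag :: "ereal ^ 'n ^ 'n \<Rightarrow> real \<Rightarrow> ereal ^ 'n ^ 'n" where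
  "shift_off_diag A \<mu> = (\<chi> i j. if i = j then 0 else A $ i $ j - ereal \<mu>)"

definition ereal_vec :: "real ^ 'n \<Rightarrow> ereal ^ 'n" where
  "ereal_vec x = (\<chi> i. ereal (x $ i))"

text \<open>Only eigenvectors with full support, for the eigenvalue \<open>0\<close> of a definite matrix.\<close>

definition eig :: "ereal ^ 'n ^ 'n \<Rightarrow> (real ^ 'n) set" where
  "eig B = {x. B \<odot> ereal_vec x = ereal_vec x}"

definition supporting_plane :: "ereal ^ 'n ^ 'n \<Rightarrow> 'n \<Rightarrow> 'n \<Rightarrow> (real ^ 'n) set" where
  "supporting_plane A i j = {x. ereal (x $ i - x $ j) = A $ i $ j}"

definition face :: "ereal ^ 'n ^ 'n \<Rightarrow> 'n \<Rightarrow> 'n \<Rightarrow> (real ^ 'n) set" where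
  "face A i j = supporting_plane A i j \<inter> eig A"

definition eig_boundary :: "ereal ^ 'n ^ 'n \<Rightarrow> (real ^ 'n) set" where
  "eig_boundary A = \<Union> {face A i j | i j. i \<noteq> j \<and> A $ i $ j \<noteq> -\<infinity>}"

definition hilbert_dist :: "real ^ 'n \<Rightarrow> real ^ 'n \<Rightarrow> real" where
  "hilbert_dist x y = Max {x $ i - x $ j - y $ i + y $ j | i j. True}"

text \<open>The infimum is taken in \<^typ>\<open>ereal\<close>, so the distance to the empty set is \<open>\<infinity>\<close>.\<close>

definition hilbert_setdist :: "real ^ 'n \<Rightarrow> (real ^ 'n) set \<Rightarrow> ereal" where
  "hilbert_setdist y Z = (INF z\<in>Z. ereal (hilbert_dist y z))"

end

theory Submission
  imports Defs
begin

text \<open>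
  For a definite matrix \<open>A\<close>, \<open>y \<in> eig A\<close> means that all slacks \<open>y\<^sub>i - y\<^sub>j - A\<^sub>i\<^sub>j\<close> are nonnegative, and
  \<open>y \<in> eig A\<^sub>\<mu>\<close> means that the off-diagonal ones are at least \<open>-\<mu>\<close>. On a face \<open>\<Gamma>\<^sub>i\<^sub>j\<close> the slack of
  \<open>(i, j)\<close> vanishes, which gives the lower bounds. Along a critical cycle of the off-diagonal part
  the slacks sum to \<open>-|K| \<lambda>\<close>, so one of them is at most \<open>-\<lambda>\<close>, and all are equal to \<open>-\<lambda>\<close> if
  \<open>y \<in> eig A\<^sub>\<lambda>\<close>. Decreasing \<open>y\<^sub>i\<close> by the minimal slack of row \<open>i\<close> moves \<open>y\<close> to a face of \<open>eig A\<close>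
  at a Hilbert distance of at most that slack.
\<close>

section \<open>Eigenvectors as solutions of two-variable inequalities\<close>

text \<open>With a zero diagonal the term \<open>k = i\<close> of the maximum is exactly
  \<open>x $ i\<close>, so equality in row \<open>i\<close> says only that no other term exceeds
  it.\<close>

lemma mem_eig_iff:
  fixes B :: "ereal ^ 'n ^ 'n"
  assumes "\<And>i. B $ i $ i = 0"
  shows "x \<in> eig B \<longleftrightarrow> (\<forall>i j. B $ i $ j + ereal (x $ j) \<le> ereal (x $ i))"
proof -
  have "(MAX k. B $ i $ k + ereal (x $ k)) = ereal (x $ i) \<longleftrightarrow>
      (\<forall>j. B $ i $ j + ereal (x $ j) \<le> ereal (x $ i))" for i
  proof
    assume "(MAX k. B $ i $ k + ereal (x $ k)) = ereal (x $ i)"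
    moreover have "B $ i $ j + ereal (x $ j) \<le> (MAX k. B $ i $ k + ereal (x $ k))" for j
      by (intro Max_ge) auto
    ultimately show "\<forall>j. B $ i $ j + ereal (x $ j) \<le> ereal (x $ i)"
      by simp
  next
    assume *: "\<forall>j. B $ i $ j + ereal (x $ j) \<le> ereal (x $ i)"
    have "ereal (x $ i) \<in> range (\<lambda>k. B $ i $ k + ereal (x $ k))"
      by (rule range_eqI[of _ _ i]) (simp add: assms)
    with * show "(MAX k. B $ i $ k + ereal (x $ k)) = ereal (x $ i)"
      by (intro Max_eqI) auto
  qed
  then show ?thesis
    by (simp add: eig_def mp_mult_vec_def ereal_vec_def vec_eq_iff)
qed

lemma shift_off_diag_slack:
  fixes A :: "ereal ^ 'n ^ 'n"
  assumes "y \<in> eig (shift_off_diag A \<mu>)" and "i \<noteq> j"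
  shows "A $ i $ j + ereal (y $ j) \<le> ereal (y $ i + \<mu>)"
proof -
  have "\<And>i. shift_off_diag A \<mu> $ i $ i = 0"
    by (simp add: shift_off_diag_def)
  with assms(1) have "shift_off_diag A \<mu> $ i $ j + ereal (y $ j) \<le> ereal (y $ i)"
    using mem_eig_iff by blast
  with \<open>i \<noteq> j\<close> show ?thesis
    by (cases "A $ i $ j") (auto simp: shift_off_diag_def)
qed

section \<open>Hilbert distance and faces\<close>

lemma hilbert_dist_ge:
  fixes x y :: "real ^ 'n"
  shows "x $ i - x $ j - y $ i + y $ j \<le> hilbert_dist x y"
proof -
  have "{x $ i - x $ j - y $ i + y $ j | i j. True}
      = (\<lambda>(i, j). x $ i - x $ j - y $ i + y $ j) ` UNIV"
    by auto
  then have "finite {x $ i - x $ j - y $ i + y $ j | i j. True}"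
    by simp
  then show ?thesis
    unfolding hilbert_dist_def by (intro Max_ge) auto
qed

lemma hilbert_dist_le:
  fixes x y :: "real ^ 'n"
  assumes "\<And>i j. x $ i - x $ j - y $ i + y $ j \<le> c"
  shows "hilbert_dist x y \<le> c"
proof -
  have "{x $ i - x $ j - y $ i + y $ j | i j. True}
      = (\<lambda>(i, j). x $ i - x $ j - y $ i + y $ j) ` UNIV"
    by auto
  then have "finite {x $ i - x $ j - y $ i + y $ j | i j. True}"
    by simp
  then show ?thesis
    unfolding hilbert_dist_def using assms by (subst Max_le_iff) auto
qed

text \<open>Since \<open>A $ i $ j = z $ i - z $ j\<close> on the face, the slack of
  \<open>(i, j)\<close> at \<open>y\<close> is one of the terms whose maximum is
  \<open>hilbert_dist y z\<close>.\<close>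

lemma hilbert_dist_face_ge:
  fixes A :: "ereal ^ 'n ^ 'n"
  assumes "y \<in> eig (shift_off_diag A \<mu>)" and "i \<noteq> j" and "z \<in> face A i j"
  shows "- \<mu> \<le> hilbert_dist y z"
proof -
  have "A $ i $ j = ereal (z $ i - z $ j)"
    using assms(3) by (simp add: face_def supporting_plane_def)
  with shift_off_diag_slack[OF assms(1,2)] have "- \<mu> \<le> y $ i - y $ j - z $ i + z $ j"
    by simp
  also have "\<dots> \<le> hilbert_dist y z"
    by (rule hilbert_dist_ge)
  finally show ?thesis .
qed

text \<open>Lowering \<open>y $ i\<close> alone by \<open>t\<close> only relaxes the inequalities of
  the other rows; row \<open>i\<close> survives because all its off-diagonal slacks are at least
  \<open>t\<close>, and the slack of \<open>(i, j)\<close> drops to 0.\<close>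

lemma hilbert_setdist_le_of_slack:
  fixes A :: "ereal ^ 'n ^ 'n"
  assumes diag: "\<And>i. A $ i $ i = 0" and y: "y \<in> eig A" and "0 \<le> t"
    and row: "\<And>k. k \<noteq> i \<Longrightarrow> A $ i $ k + ereal (y $ k) \<le> ereal (y $ i - t)"
    and "i \<noteq> j" and tight: "A $ i $ j + ereal (y $ j) = ereal (y $ i - t)"
  shows "hilbert_setdist y (face A i j) \<le> ereal t"
proof -
  define z :: "real ^ 'n" where "z = (\<chi> k. if k = i then y $ i - t else y $ k)"
  have y': "A $ k $ l + ereal (y $ l) \<le> ereal (y $ k)" for k l
    using y mem_eig_iff[of A, OF diag] by blast
  have "A $ k $ l + ereal (z $ l) \<le> ereal (z $ k)" for k l
  proof (cases "k = i")
    case True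
    then show ?thesis
      using row[of l] diag by (auto simp: z_def)
  next
    case False
    have "A $ k $ l + ereal (z $ l) \<le> A $ k $ l + ereal (y $ l)"
      using \<open>0 \<le> t\<close> by (intro add_left_mono) (auto simp: z_def)
    also note y'
    finally show ?thesis
      using False by (simp add: z_def)
  qed
  then have "z \<in> eig A"
    using mem_eig_iff[of A, OF diag] by blast
  moreover have "z \<in> supporting_plane A i j"
    using tight \<open>i \<noteq> j\<close> by (cases "A $ i $ j") (auto simp: supporting_plane_def z_def)
  ultimately have "hilbert_setdist y (face A i j) \<le> ereal (hilbert_dist y z)"
    unfolding hilbert_setdist_def face_def by (intro INF_lower) auto
  \<comment> \<open>The points differ in one coordinate, so each term of the maximum is
    \<open>-t\<close>, 0 or \<open>t\<close>.\<close>
  also have "\<dots> \<le> ereal t"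
    using \<open>0 \<le> t\<close> by (auto simp: z_def intro!: hilbert_dist_le)
  finally show ?thesis .
qed

section \<open>Cycle means and slacks along a cycle\<close>

lemma cycle_mean_le_max_cycle_mean:
  fixes A :: "ereal ^ 'n ^ 'n"
  assumes "cyclic_perm K \<tau>"
  shows "cycle_mean A K \<tau> \<le> max_cycle_mean A"
proof -
  have "{cycle_mean A K \<tau> | K \<tau>. cyclic_perm K \<tau>}
      \<subseteq> (\<lambda>(K, \<tau>). cycle_mean A K \<tau>) ` UNIV"
    by auto
  then have "finite {cycle_mean A K \<tau> | K \<tau>. cyclic_perm K \<tau>}"
    by (rule finite_subset) simp
  then show ?thesis
    unfolding max_cycle_mean_def using assms by (intro Max_ge) auto
qed

lemma cyclic_perm_nonempty: "cyclic_perm K \<tau> \<Longrightarrow> K \<noteq> {}"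
  by (auto simp: cyclic_perm_def cyclic_on_def orbit_nonempty)

text \<open>One entry \<open>-\<infinity>\<close> on the cycle would make the whole mean
  \<open>-\<infinity>\<close>. As \<open>off_diag\<close> has such a diagonal, this also excludes
  fixed points of \<open>\<tau>\<close> in \<open>K\<close>.\<close>

lemma cycle_entries_finite:
  fixes A :: "ereal ^ 'n ^ 'n"
  assumes A: "maxplus_matrix A"
    and mean: "cycle_mean (off_diag A) K \<tau> = ereal l" and "i \<in> K"
  shows "i \<noteq> \<tau> i" and "A $ i $ \<tau> i = ereal (real_of_ereal (A $ i $ \<tau> i))"
proof -
  have "off_diag A $ i $ \<tau> i \<noteq> -\<infinity>"
  proof
    assume *: "off_diag A $ i $ \<tau> i = -\<infinity>"
    \<comment> \<open>In \<open>ereal\<close>, \<open>\<infinity> + -\<infinity>\<close> is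
      \<open>\<infinity>\<close>, so \<open>-\<infinity>\<close> absorbs the rest of the sum only
      when that rest is not \<open>\<infinity>\<close>.\<close>
    have "(\<Sum>k\<in>K - {i}. off_diag A $ k $ \<tau> k) \<noteq> \<infinity>"
      using A by (subst sum_Pinfty) (simp add: off_diag_def maxplus_matrix_def)
    then have "(\<Sum>k\<in>K. off_diag A $ k $ \<tau> k) = -\<infinity>"
      using * \<open>i \<in> K\<close> by (subst sum.remove[of K i]) auto
    moreover have "0 < card K"
      using \<open>i \<in> K\<close> by (auto simp: card_gt_0_iff)
    ultimately show False
      using mean by (simp add: cycle_mean_def)
  qed
  then have "i \<noteq> \<tau> i" and "A $ i $ \<tau> i \<noteq> -\<infinity>"
    by (auto simp: off_diag_def split: if_splits)
  moreover have "A $ i $ \<tau> i \<noteq> \<infinity>"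
    using A by (simp add: maxplus_matrix_def)
  ultimately show "i \<noteq> \<tau> i" and "A $ i $ \<tau> i = ereal (real_of_ereal (A $ i $ \<tau> i))"
    by (auto simp: ereal_real)
qed

text \<open>The terms in \<open>y\<close> cancel because \<open>\<tau>\<close> permutes
  \<open>K\<close>; what remains is minus the weight of the cycle.\<close>

lemma sum_slack_cycle:
  fixes A :: "ereal ^ 'n ^ 'n" and y :: "real ^ 'n"
  assumes A: "maxplus_matrix A" and cyc: "cyclic_perm K \<tau>"
    and mean: "cycle_mean (off_diag A) K \<tau> = ereal l"
  shows "(\<Sum>i\<in>K. y $ i - y $ \<tau> i - real_of_ereal (A $ i $ \<tau> i)) = - real (card K) * l"
proof -
  have fin: "i \<noteq> \<tau> i" "A $ i $ \<tau> i = ereal (real_of_ereal (A $ i $ \<tau> i))" if "i \<in> K" for i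
    using cycle_entries_finite[OF A mean that] .
  have "(\<Sum>i\<in>K. off_diag A $ i $ \<tau> i) = (\<Sum>i\<in>K. ereal (real_of_ereal (A $ i $ \<tau> i)))"
    using fin(1) by (intro sum.cong refl) (simp add: off_diag_def fin(2)[symmetric])
  also have "\<dots> = ereal (\<Sum>i\<in>K. real_of_ereal (A $ i $ \<tau> i))"
    by simp
  finally have "(\<Sum>i\<in>K. real_of_ereal (A $ i $ \<tau> i)) / real (card K) = l"
    using mean cyclic_perm_nonempty[OF cyc] by (simp add: cycle_mean_def)
  moreover have "real (card K) \<noteq> 0"
    using cyclic_perm_nonempty[OF cyc] by simp
  ultimately have "(\<Sum>i\<in>K. real_of_ereal (A $ i $ \<tau> i)) = real (card K) * l"
    by (metis nonzero_mult_div_cancel_left times_divide_eq_right)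
  moreover have "(\<Sum>i\<in>K. y $ \<tau> i) = (\<Sum>i\<in>K. y $ i)"
    using cyc sum.permute[of \<tau> K "\<lambda>i. y $ i"] by (simp add: cyclic_perm_def o_def)
  ultimately show ?thesis
    by (simp add: sum_subtractf)
qed

section \<open>Distances from critical cycles\<close>

lemma hilbert_setdist_eig_boundary_le:
  fixes A :: "ereal ^ 'n ^ 'n"
  assumes A: "maxplus_matrix A" and diag: "\<And>i. A $ i $ i = 0" and cyc: "cyclic_perm K \<tau>"
    and mean: "cycle_mean (off_diag A) K \<tau> = ereal l" and y: "y \<in> eig A"
  shows "hilbert_setdist y (eig_boundary A) \<le> ereal (- l)"
proof -
  let ?s = "\<lambda>i k. y $ i - y $ k - real_of_ereal (A $ i $ k)"
  \<comment> \<open>The slacks along the cycle have average \<open>- l\<close>.\<close>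
  have "\<exists>i\<in>K. ?s i (\<tau> i) \<le> - l"
  proof (rule ccontr)
    assume "\<not> ?thesis"
    then have "(\<Sum>i\<in>K. - l) < (\<Sum>i\<in>K. ?s i (\<tau> i))"
      using cyclic_perm_nonempty[OF cyc] by (intro sum_strict_mono) auto
    then show False
      using sum_slack_cycle[OF A cyc mean, of y] by simp
  qed
  then obtain i where "i \<in> K" and i: "?s i (\<tau> i) \<le> - l"
    by blast
  \<comment> \<open>Entries \<open>-\<infinity>\<close> are left out: \<open>real_of_ereal\<close>
    sends them to 0, which would give a meaningless slack, and they impose no constraint.\<close>
  define S where "S = {k. k \<noteq> i \<and> A $ i $ k \<noteq> -\<infinity>}"
  have "\<tau> i \<in> S"
    using cycle_entries_finite[OF A mean \<open>i \<in> K\<close>] by (metis (mono_tags, lifting) MInfty_neq_ereal(1) S_def mem_Collect_eq)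
  \<comment> \<open>The tightest constraint of row \<open>i\<close> is reached first when
    \<open>y $ i\<close> decreases; going on to the slack of \<open>(i, \<tau> i)\<close> could
    leave \<open>eig A\<close>.\<close>
  define j where "j = arg_min_on (?s i) S"
  have "j \<in> S"
    unfolding j_def using \<open>\<tau> i \<in> S\<close> by (intro arg_min_if_finite(1)) auto
  have j_min: "?s i j \<le> ?s i k" if "k \<in> S" for k
    unfolding j_def using that by (intro arg_min_least) auto
  have fin: "A $ i $ k = ereal (real_of_ereal (A $ i $ k))" if "k \<in> S" for k
    using that A by (auto simp: S_def maxplus_matrix_def ereal_real)
  have "A $ i $ j + ereal (y $ j) \<le> ereal (y $ i)"
    using y mem_eig_iff[of A, OF diag] by blast
  then have "0 \<le> ?s i j"
    by (subst (asm) fin[OF \<open>j \<in> S\<close>]) simp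
  have "hilbert_setdist y (face A i j) \<le> ereal (?s i j)"
  proof (rule hilbert_setdist_le_of_slack[OF diag y \<open>0 \<le> ?s i j\<close>])
    show "A $ i $ k + ereal (y $ k) \<le> ereal (y $ i - ?s i j)" if "k \<noteq> i" for k
    proof (cases "k \<in> S")
      case True
      show ?thesis
        using j_min[OF True] by (subst fin[OF True]) simp
    next
      case False
      then show ?thesis
        using that by (simp add: S_def)
    qed
    show "A $ i $ j + ereal (y $ j) = ereal (y $ i - ?s i j)"
      by (subst fin[OF \<open>j \<in> S\<close>]) simp
    show "i \<noteq> j"
      using \<open>j \<in> S\<close> by (auto simp: S_def)
  qed
  moreover have "face A i j \<subseteq> eig_boundary A"
    unfolding eig_boundary_def using \<open>j \<in> S\<close>[unfolded S_def] by blast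
  then have "hilbert_setdist y (eig_boundary A) \<le> hilbert_setdist y (face A i j)"
    unfolding hilbert_setdist_def by (intro INF_superset_mono) auto
  moreover have "?s i j \<le> - l"
    using j_min[OF \<open>\<tau> i \<in> S\<close>] i by simp
  ultimately show ?thesis
    by (meson ereal_less_eq(3) order_trans)
qed

lemma hilbert_setdist_face_eq:
  fixes A :: "ereal ^ 'n ^ 'n"
  assumes A: "maxplus_matrix A" and diag: "\<And>i. A $ i $ i = 0" and cyc: "cyclic_perm K \<tau>"
    and mean: "cycle_mean (off_diag A) K \<tau> = ereal l" and "l \<le> 0"
    and y: "y \<in> eig (shift_off_diag A l)" and "i \<in> K"
  shows "hilbert_setdist y (face A i (\<tau> i)) = ereal (- l)"
proof (rule antisym)
  let ?s = "\<lambda>i k. y $ i - y $ k - real_of_ereal (A $ i $ k)"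
  have fin: "k \<noteq> \<tau> k" "A $ k $ \<tau> k = ereal (real_of_ereal (A $ k $ \<tau> k))" if "k \<in> K" for k
    using cycle_entries_finite[OF A mean that] .
  have slack: "0 \<le> ?s k (\<tau> k) + l" if "k \<in> K" for k
    using shift_off_diag_slack[OF y fin(1)[OF that]]
    by (subst (asm) fin(2)[OF that]) simp
  \<comment> \<open>Nonnegative terms with sum 0 all vanish, so every slack on the cycle is exactly
    \<open>- l\<close>.\<close>
  have "(\<Sum>k\<in>K. ?s k (\<tau> k) + l) = 0"
    using sum_slack_cycle[OF A cyc mean, of y] by (simp add: sum.distrib)
  moreover have "(\<Sum>k\<in>K. ?s k (\<tau> k) + l) = 0 \<longleftrightarrow> (\<forall>k\<in>K. ?s k (\<tau> k) + l = 0)"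
    by (intro sum_nonneg_eq_0_iff slack) simp_all
  ultimately have "?s i (\<tau> i) + l = 0"
    using \<open>i \<in> K\<close> by blast
  \<comment> \<open>The form \<open>- - l\<close> matches \<open>hilbert_setdist_le_of_slack\<close>
    with \<open>t = - l\<close>.\<close>
  then have tight: "A $ i $ \<tau> i + ereal (y $ \<tau> i) = ereal (y $ i - - l)"
    by (subst fin(2)[OF \<open>i \<in> K\<close>]) simp
  have row: "A $ k $ m + ereal (y $ m) \<le> ereal (y $ k - - l)" if "m \<noteq> k" for k m
    using shift_off_diag_slack[OF y that[symmetric]] by simp
  \<comment> \<open>As \<open>l \<le> 0\<close>, the off-diagonal inequalities of the shifted matrix
    are stricter than those of \<open>A\<close>.\<close>
  have "A $ k $ m + ereal (y $ m) \<le> ereal (y $ k)" for k m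
  proof (cases "m = k")
    case False
    have "ereal (y $ k - - l) \<le> ereal (y $ k)"
      using \<open>l \<le> 0\<close> by simp
    with row[OF False] show ?thesis
      by (rule order_trans)
  qed (simp add: diag)
  then have "y \<in> eig A"
    using mem_eig_iff[of A, OF diag] by blast
  then show "hilbert_setdist y (face A i (\<tau> i)) \<le> ereal (- l)"
    using hilbert_setdist_le_of_slack[OF diag _ _ row fin(1)[OF \<open>i \<in> K\<close>] tight] \<open>l \<le> 0\<close> by simp
  show "ereal (- l) \<le> hilbert_setdist y (face A i (\<tau> i))"
    unfolding hilbert_setdist_def using hilbert_dist_face_ge[OF y fin(1)[OF \<open>i \<in> K\<close>]]
    by (auto intro!: INF_greatest)
qed

section \<open>Sign of the maximal cycle mean and conclusion\<close>

text \<open>Putting \<open>-\<infinity>\<close> on the diagonal can only lower cycle means, and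
  those of \<open>A\<close> are at most 0. The bound excludes the value \<open>\<infinity>\<close>
  and makes \<open>- l\<close> a nonnegative distance.\<close>

lemma max_cycle_mean_off_diag_nonpos:
  fixes A :: "ereal ^ 'n ^ 'n"
  assumes "definite A" and "critical_perm (off_diag A) K \<tau>"
  shows "max_cycle_mean (off_diag A) \<le> 0"
proof -
  have cyc: "cyclic_perm K \<tau>"
    using assms(2) by (simp add: critical_perm_def)
  have "(\<Sum>i\<in>K. off_diag A $ i $ \<tau> i) \<le> (\<Sum>i\<in>K. A $ i $ \<tau> i)"
    by (intro sum_mono) (simp add: off_diag_def)
  moreover have "0 < card K"
    using cyclic_perm_nonempty[OF cyc] by (simp add: card_gt_0_iff)
  ultimately have "cycle_mean (off_diag A) K \<tau> \<le> cycle_mean A K \<tau>"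
    unfolding cycle_mean_def by (intro ereal_divide_right_mono) auto
  also have "\<dots> \<le> max_cycle_mean A"
    using cyc by (rule cycle_mean_le_max_cycle_mean)
  finally show ?thesis
    using assms by (simp add: critical_perm_def definite_def)
qed

theorem proposition17:
  fixes A :: "ereal ^ 'n ^ 'n" and K :: "'n set" and \<tau> :: "'n \<Rightarrow> 'n"
  assumes "maxplus_matrix A"
    and "definite A"
    and "\<exists>i j. i \<noteq> j \<and> A $ i $ j \<noteq> -\<infinity>"
    and "critical_perm (off_diag A) K \<tau>"
  shows "(max_cycle_mean (off_diag A) > -\<infinity> \<longrightarrow>
            (\<forall>y\<in>eig A. hilbert_setdist y (eig_boundary A) \<le> - max_cycle_mean (off_diag A)))
       \<and> (\<forall>\<mu>::real.
            (max_cycle_mean (off_diag A) > -\<infinity> \<longrightarrow> max_cycle_mean (off_diag A) \<le> ereal \<mu>) \<and> \<mu> < 0 \<longrightarrow>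
            (\<forall>y\<in>eig (shift_off_diag A \<mu>). hilbert_setdist y (eig_boundary A) \<ge> ereal (- \<mu>)))
       \<and> (max_cycle_mean (off_diag A) > -\<infinity> \<longrightarrow>
            (\<forall>i\<in>K. \<forall>j\<in>K. j = \<tau> i \<longrightarrow>
              (\<forall>y\<in>eig (shift_off_diag A (real_of_ereal (max_cycle_mean (off_diag A)))).
                 hilbert_setdist y (face A i j) = - max_cycle_mean (off_diag A))))"
proof (intro conjI impI allI ballI)
  have diag: "\<And>i. A $ i $ i = 0"
    using assms(2) by (simp add: definite_def)
  have cyc: "cyclic_perm K \<tau>"
    using assms(4) by (simp add: critical_perm_def)
  have nonpos: "max_cycle_mean (off_diag A) \<le> 0"
    using assms(2,4) by (rule max_cycle_mean_off_diag_nonpos)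
  have real: "max_cycle_mean (off_diag A) = ereal (real_of_ereal (max_cycle_mean (off_diag A)))"
    if "max_cycle_mean (off_diag A) > -\<infinity>"
    using that nonpos by (cases "max_cycle_mean (off_diag A)") auto
  have mean: "cycle_mean (off_diag A) K \<tau> = ereal (real_of_ereal (max_cycle_mean (off_diag A)))"
    if "max_cycle_mean (off_diag A) > -\<infinity>"
    using assms(4) real[OF that] by (simp add: critical_perm_def)
  show "hilbert_setdist y (eig_boundary A) \<le> - max_cycle_mean (off_diag A)"
    if "max_cycle_mean (off_diag A) > -\<infinity>" and "y \<in> eig A" for y
    using hilbert_setdist_eig_boundary_le[OF assms(1) diag cyc mean[OF that(1)] that(2)]
    by (subst real[OF that(1)]) simp
  \<comment> \<open>Each boundary point lies on a face with \<open>i \<noteq> j\<close>, so the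
    bound for single faces passes to the infimum over their union.\<close>
  show "ereal (- \<mu>) \<le> hilbert_setdist y (eig_boundary A)"
    if "y \<in> eig (shift_off_diag A \<mu>)" for \<mu> y
    unfolding hilbert_setdist_def eig_boundary_def
    using hilbert_dist_face_ge[OF that] by (auto intro!: INF_greatest)
  show "hilbert_setdist y (face A i j) = - max_cycle_mean (off_diag A)"
    if "max_cycle_mean (off_diag A) > -\<infinity>" and "i \<in> K" and "j = \<tau> i"
      and "y \<in> eig (shift_off_diag A (real_of_ereal (max_cycle_mean (off_diag A))))" for i j y
  proof -
    have "real_of_ereal (max_cycle_mean (off_diag A)) \<le> 0"
      using nonpos by simp
    from hilbert_setdist_face_eq[OF assms(1) diag cyc mean[OF that(1)] this that(4,2)]
    show ?thesis
      unfolding that(3) by (metis real[OF that(1)] uminus_ereal.simps(1))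
  qed
qed

end
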